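(* Every biordered forest with code $(\pi,p)$ induces an alternation acyclic tournament $T=T(\pi,p)$. Furthermore, the permutation $\pi$ is a linear extension of the right alternating walk order induced by $T$.
   Context: A tournament $T$ on $\{1,\ldots,n\}$ is a directed graph without loops or multiple edges in which for every pair $\{i,j\}$ exactly one of $i\rightarrow j$, $j\rightarrow i$ is an edge. An edge $i\rightarrow j$ is an ascent if $i<j$ and a descent if $i>j$. A directed cycle is alternating if ascents and descents alternate along it, and $T$ is alternation acyclic if it contains no alternating cycle. In $T$ there is a right-alternating walk from $u$ to $v$ (written $u \preceq v$) if $u=v$ or there is a directed walk $u=w_0\rightarrow w_1\rightarrow\cdots\rightarrow w_{2i}=v$ in which $w_0\rightarrow w_1$ is a descent, and descents and ascents alternate, the last edge being an ascent; $\preceq$ is the right alternating walk order induced by $T$ (it is a partial order exactly when $T$ is alternation acyclic). A biordered forest on $n$ elements is encoded by a code $(\pi,p)$, where $\pi$ is a permutation of $\{1,\ldots,n\}$ and $p:\{1,\ldots,n\}\rightarrow\{2,\ldots,n\}\cup\{\infty\}$ is a parent function satisfying $p(i)>i$ for all $i$. The tournament $T(\pi,p)$ induced by the biordered forest has vertex set $\{1,\ldots,n\}$ and, for all $u<v$, contains the ascent $u\rightarrow v$ if $p(u)\neq\infty$ and $\pi^{-1}(v)\geq \pi^{-1}(p(u))$, and otherwise contains the descent $v\rightarrow u$. A permutation $\pi$ is a linear extension of $\preceq$ if $u\preceq v$ implies $\pi^{-1}(u)\leq\pi^{-1}(v)$. *)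

theory Defs
  imports
    "Graph_Theory.Pair_Digraph"
    "HOL-Combinatorics.Permutations"
    "HOL-Library.Extended_Nat"
begin

locale tournament = pair_digraph T for n :: nat and T :: "nat pair_pre_digraph" +
  assumes verts_eq: "pverts T = {1..n}"
    and exactly_one_arc:
      "\<lbrakk>i \<in> {1..n}; j \<in> {1..n}; i \<noteq> j\<rbrakk> \<Longrightarrow> (i, j) \<in> parcs T \<longleftrightarrow> (j, i) \<notin> parcs T"

definition ascent :: "nat \<times> nat \<Rightarrow> bool" where
  "ascent e \<longleftrightarrow> fst e < snd e"

definition descent :: "nat \<times> nat \<Rightarrow> bool" where
  "descent e \<longleftrightarrow> fst e > snd e"

text \<open>Cycles and walks are lists of arcs. Alternation along a cycle is cyclic: the last arc
  and the first arc also have to be of different kinds, so a 3-cycle is never alternating.\<close>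

definition alternating_cycle :: "nat pair_pre_digraph \<Rightarrow> (nat \<times> nat) list \<Rightarrow> bool" where
  "alternating_cycle T c \<longleftrightarrow> pre_digraph.cycle (with_proj T) c \<and>
    (\<forall>i < length c. let e = c ! i; e' = c ! (Suc i mod length c)
       in ascent e \<and> descent e' \<or> descent e \<and> ascent e')"

definition alternation_acyclic :: "nat pair_pre_digraph \<Rightarrow> bool" where
  "alternation_acyclic T \<longleftrightarrow> \<not> (\<exists>c. alternating_cycle T c)"

definition right_alternating_walk ::
    "nat pair_pre_digraph \<Rightarrow> nat \<Rightarrow> (nat \<times> nat) list \<Rightarrow> nat \<Rightarrow> bool" where
  "right_alternating_walk T u w v \<longleftrightarrow> pre_digraph.awalk (with_proj T) u w v \<and>
    w \<noteq> [] \<and> even (length w) \<and>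
    (\<forall>i < length w. if even i then descent (w ! i) else ascent (w ! i))"

definition right_alternating_walk_order :: "nat pair_pre_digraph \<Rightarrow> nat rel" where
  "right_alternating_walk_order T =
    {(u, v). u \<in> pverts T \<and> v \<in> pverts T \<and> (u = v \<or> (\<exists>w. right_alternating_walk T u w v))}"

text \<open>A permutation \<open>\<pi>\<close> is read as the word \<open>\<pi> 1, \<dots>, \<pi> n\<close>, so \<^term>\<open>inv \<pi> v\<close> is the
  position of \<open>v\<close> in it.\<close>

definition linear_extension :: "nat \<Rightarrow> (nat \<Rightarrow> nat) \<Rightarrow> nat rel \<Rightarrow> bool" where
  "linear_extension n \<pi> r \<longleftrightarrow> \<pi> permutes {1..n} \<and> (\<forall>(u, v) \<in> r. inv \<pi> u \<le> inv \<pi> v)"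

text \<open>The parent function takes the value \<^term>\<open>\<infinity> :: enat\<close> at the roots. Its values outside
  \<open>{1..n}\<close> are irrelevant.\<close>

definition biordered_forest_code :: "nat \<Rightarrow> (nat \<Rightarrow> nat) \<Rightarrow> (nat \<Rightarrow> enat) \<Rightarrow> bool" where
  "biordered_forest_code n \<pi> p \<longleftrightarrow> \<pi> permutes {1..n} \<and>
    (\<forall>i \<in> {1..n}. p i \<in> enat ` {2..n} \<union> {\<infinity>} \<and> p i > enat i)"

definition induced_ascent :: "(nat \<Rightarrow> nat) \<Rightarrow> (nat \<Rightarrow> enat) \<Rightarrow> nat \<Rightarrow> nat \<Rightarrow> bool" where
  "induced_ascent \<pi> p u v \<longleftrightarrow> p u \<noteq> \<infinity> \<and> inv \<pi> v \<ge> inv \<pi> (the_enat (p u))"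

definition induced_tournament ::
    "nat \<Rightarrow> (nat \<Rightarrow> nat) \<Rightarrow> (nat \<Rightarrow> enat) \<Rightarrow> nat pair_pre_digraph" where
  "induced_tournament n \<pi> p = \<lparr> pverts = {1..n}, parcs =
      {(u, v) | u v. u \<in> {1..n} \<and> v \<in> {1..n} \<and> u < v \<and> induced_ascent \<pi> p u v} \<union>
      {(v, u) | u v. u \<in> {1..n} \<and> v \<in> {1..n} \<and> u < v \<and> \<not> induced_ascent \<pi> p u v} \<rparr>"

end

(* A descent u -> w says that p w is infinite or lies strictly to the right of u in the word \<pi>;
   an ascent w -> v says that p w is finite and lies weakly to the left of v. So a descent
   followed by an ascent moves strictly to the right, which bounds right alternating walks and,
   at the rightmost tail of a descent, rules out alternating cycles. *)

theory Submission
  imports Defs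
begin

lemma cas_nth_Suc:
  "pre_digraph.cas G u es v \<Longrightarrow> Suc i < length es \<Longrightarrow>
    head G (es ! i) = tail G (es ! Suc i)"
proof (induction es arbitrary: u i)
  case (Cons e es)
  then show ?case
    by (cases i; cases es) (auto simp: pre_digraph.cas.simps)
qed simp

lemma cas_last_hd:
  "pre_digraph.cas G u es v \<Longrightarrow> es \<noteq> [] \<Longrightarrow> tail G (hd es) = u \<and> head G (last es) = v"
  by (induction es arbitrary: u) (auto simp: pre_digraph.cas.simps)

text \<open>At the last index the successor wraps around to 0: the walk is closed, so the head of
  its last arc and the tail of its first arc are both \<open>u\<close>. This matches the cyclic
  indexing in \<open>alternating_cycle\<close>.\<close>

lemma closed_cas_nth_Suc_mod:
  assumes "pre_digraph.cas G u es u" "i < length es"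
  shows "head G (es ! i) = tail G (es ! (Suc i mod length es))"
proof (cases "Suc i = length es")
  case True
  then have "es \<noteq> []" "i = length es - 1"
    by auto
  then show ?thesis
    using cas_last_hd[OF assms(1)] True by (simp add: last_conv_nth hd_conv_nth)
next
  case False
  then show ?thesis
    using cas_nth_Suc[OF assms(1), of i] assms(2) by simp
qed

text \<open>The shared vertex \<open>snd e\<close> is the smaller end of both arcs, so the same
  value of \<open>p\<close> decides both. The ascent makes that parent finite, and the position of
  the parent then separates \<open>fst e\<close> from \<open>snd e'\<close>: strictly on the side of
  the descent, weakly on the side of the ascent.\<close>

lemma induced_tournament_descent_ascent:
  assumes "e \<in> parcs (induced_tournament n \<pi> p)" "descent e"
    and "e' \<in> parcs (induced_tournament n \<pi> p)" "ascent e'"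
    and "snd e = fst e'"
  shows "inv \<pi> (fst e) < inv \<pi> (snd e')"
  using assms
  by (auto simp: induced_tournament_def induced_ascent_def descent_def ascent_def)

lemma tournament_induced_tournament: "tournament n (induced_tournament n \<pi> p)"
proof
  show "finite (parcs (induced_tournament n \<pi> p))"
    by (rule finite_subset[of _ "{1..n} \<times> {1..n}"]) (auto simp: induced_tournament_def)
next
  fix i j
  assume "i \<in> {1..n}" "j \<in> {1..n}" "i \<noteq> j"
  then show "(i, j) \<in> parcs (induced_tournament n \<pi> p) \<longleftrightarrow>
      (j, i) \<notin> parcs (induced_tournament n \<pi> p)"
    by (cases i j rule: linorder_cases) (auto simp: induced_tournament_def)
qed (auto simp: induced_tournament_def)

lemma right_alternating_walk_inv_less:
  assumes "right_alternating_walk (induced_tournament n \<pi> p) u w v"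
  shows "inv \<pi> u < inv \<pi> v"
proof -
  let ?T = "induced_tournament n \<pi> p"
  \<comment> \<open>The weak inequality covers the empty walk, so that the induction can remove a
    descent and an ascent at a time; a single arc is excluded by parity.\<close>
  have le: "inv \<pi> u \<le> inv \<pi> v \<and> (w \<noteq> [] \<longrightarrow> inv \<pi> u < inv \<pi> v)"
    if "pre_digraph.cas (with_proj ?T) u w v" "set w \<subseteq> parcs ?T" "even (length w)"
      and "\<forall>i < length w. if even i then descent (w ! i) else ascent (w ! i)"
    for u w
    using that
  proof (induction w arbitrary: u rule: induct_list012)
    case (3 e e' w)
    \<comment> \<open>Removing two arcs shifts every index by 2 and so preserves its parity.\<close>
    have "\<forall>i < length w. if even i then descent (w ! i) else ascent (w ! i)"
    proof (intro allI impI)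
      fix i assume "i < length w"
      then show "if even i then descent (w ! i) else ascent (w ! i)"
        using 3(6)[rule_format, of "Suc (Suc i)"] by (simp split: if_splits)
    qed
    then have "inv \<pi> (snd e') \<le> inv \<pi> v"
      using 3 by (auto simp: pre_digraph.cas.simps)
    moreover have "descent e" "ascent e'"
      using 3(6)[rule_format, of 0] 3(6)[rule_format, of 1] by auto
    then have "inv \<pi> u < inv \<pi> (snd e')"
      using 3 induced_tournament_descent_ascent[of e n \<pi> p e']
      by (simp add: pre_digraph.cas.simps)
    ultimately show ?case
      by simp
  qed (auto simp: pre_digraph.cas.simps)
  show ?thesis
    using assms le[of u w] by (auto simp: right_alternating_walk_def pre_digraph.awalk_def)
qed

lemma alternation_acyclic_induced_tournament:
  "alternation_acyclic (induced_tournament n \<pi> p)"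
  unfolding alternation_acyclic_def
proof
  let ?T = "induced_tournament n \<pi> p"
  assume "\<exists>c. alternating_cycle ?T c"
  then obtain c u where walk: "pre_digraph.cas (with_proj ?T) u c u" "set c \<subseteq> parcs ?T" "c \<noteq> []"
    and alt: "\<And>i. i < length c \<Longrightarrow> ascent (c ! i) \<and> descent (c ! (Suc i mod length c)) \<or>
      descent (c ! i) \<and> ascent (c ! (Suc i mod length c))"
    by (auto simp: alternating_cycle_def pre_digraph.cycle_def pre_digraph.awalk_def Let_def)
  let ?next = "\<lambda>i. Suc i mod length c"
  have next_less: "?next i < length c" for i
    using walk(3) by simp
  have exclusive: "\<not> (ascent e \<and> descent e)" for e
    by (auto simp: ascent_def descent_def)
  define D where "D = {i. i < length c \<and> descent (c ! i)}"
  have "finite D"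
    by (simp add: D_def)
  \<comment> \<open>Of the first arc and its cyclic successor, one is a descent.\<close>
  moreover have "D \<noteq> {}"
    using alt[of 0] next_less[of 0] walk(3) by (auto simp: D_def)
  \<comment> \<open>Choose a descent of the cycle whose tail stands furthest to the right in the
    word \<pi>.\<close>
  ultimately obtain i where "i \<in> D" and
    maximal: "\<And>j. j \<in> D \<Longrightarrow> inv \<pi> (fst (c ! j)) \<le> inv \<pi> (fst (c ! i))"
    using Max_in[of "(\<lambda>i. inv \<pi> (fst (c ! i))) ` D"] Max_ge[of "(\<lambda>i. inv \<pi> (fst (c ! i))) ` D"]
    by fastforce
  then have i: "i < length c" "descent (c ! i)"
    by (auto simp: D_def)
  let ?j = "?next i"
  have j: "ascent (c ! ?j)"
    using alt[OF i(1)] i(2) exclusive by blast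
  then have "descent (c ! ?next ?j)"
    using alt[OF next_less[of i]] exclusive by blast
  \<comment> \<open>Two steps along the cycle, possibly past its end, there is again a descent. Its
    tail is the head of the ascent in between, hence strictly to the right of the tail of arc
    \<open>i\<close>, against maximality.\<close>
  then have "?next ?j \<in> D"
    using next_less by (simp add: D_def)
  moreover have "snd (c ! i) = fst (c ! ?j)" "snd (c ! ?j) = fst (c ! ?next ?j)"
    using closed_cas_nth_Suc_mod[OF walk(1) i(1)] closed_cas_nth_Suc_mod[OF walk(1) next_less[of i]]
    by simp_all
  moreover have "c ! i \<in> parcs ?T" "c ! ?j \<in> parcs ?T"
    using walk(2) i(1) next_less[of i] nth_mem by blast+
  ultimately have "?next ?j \<in> D" "inv \<pi> (fst (c ! i)) < inv \<pi> (fst (c ! ?next ?j))"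
    using induced_tournament_descent_ascent[of "c ! i" n \<pi> p "c ! ?j"] i(2) j by simp_all
  then show False
    using maximal by fastforce
qed

theorem theorem3p7:
  fixes n :: nat and \<pi> :: "nat \<Rightarrow> nat" and p :: "nat \<Rightarrow> enat"
  assumes "biordered_forest_code n \<pi> p"
  shows "tournament n (induced_tournament n \<pi> p) \<and>
    alternation_acyclic (induced_tournament n \<pi> p) \<and>
    linear_extension n \<pi> (right_alternating_walk_order (induced_tournament n \<pi> p))"
proof -
  \<comment> \<open>Equal vertices have equal positions; any other related pair is joined by a walk,
    which gives a strict inequality.\<close>
  have "linear_extension n \<pi> (right_alternating_walk_order (induced_tournament n \<pi> p))"
    using assms right_alternating_walk_inv_less[of n \<pi> p]
    by (auto simp: linear_extension_def right_alternating_walk_order_def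
        biordered_forest_code_def intro: less_imp_le)
  then show ?thesis
    using tournament_induced_tournament alternation_acyclic_induced_tournament by blast
qed

end
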